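(* Let $G$ be a topological group. Then $G$ is $P\mathcal{M}$-factorizable if and only if $G$ is feathered and $\mathcal{M}$-factorizable.
   Context: All topological spaces (in particular all topological groups) are assumed Hausdorff. A continuous map $f:X\to Y$ is perfect if it is closed, onto, and all fibers $f^{-1}(y)$ are compact; a perfect homomorphism is a continuous group homomorphism that is a perfect map. A topological group $G$ is feathered if it contains a non-empty compact set $K$ of countable character in $G$, i.e. there is a countable family of open sets containing $K$ such that every open set containing $K$ contains a member of the family. A topological group $G$ is $\mathcal{M}$-factorizable if for every continuous function $f:G\to\mathbb{R}$ there are a continuous homomorphism $\varphi:G\to H$ onto a metrizable topological group $H$ and a continuous function $g:H\to\mathbb{R}$ such that $f=g\circ\varphi$. A topological group $G$ is $P\mathcal{M}$-factorizable if for every continuous function $f:G\to\mathbb{R}$ there are a perfect homomorphism $\pi:G\to H$ onto a metrizable topological group $H$ and a continuous function $g:H\to\mathbb{R}$ such that $f=g\circ\pi$. *)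

theory Defs
  imports "HOL-Analysis.Analysis" "HOL-Algebra.Group"
begin

text \<open>Hausdorff separation is part of the definition, following the convention that all
  topological groups are Hausdorff.\<close>

locale topological_group = group G for G (structure) +
  fixes T :: "'a topology"
  assumes topspace_eq_carrier: "topspace T = carrier G"
    and Hausdorff: "Hausdorff_space T"
    and continuous_mult: "continuous_map (prod_topology T T) T (\<lambda>(x, y). x \<otimes> y)"
    and continuous_inv: "continuous_map T T (\<lambda>x. inv x)"

definition countable_character_in :: "'a topology \<Rightarrow> 'a set \<Rightarrow> bool" where
  "countable_character_in T K \<longleftrightarrow>
     (\<exists>\<U>. countable \<U> \<and> (\<forall>U\<in>\<U>. openin T U \<and> K \<subseteq> U) \<and>
        (\<forall>V. openin T V \<and> K \<subseteq> V \<longrightarrow> (\<exists>U\<in>\<U>. U \<subseteq> V)))"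

definition feathered :: "'a topology \<Rightarrow> bool" where
  "feathered T \<longleftrightarrow> (\<exists>K. K \<noteq> {} \<and> compactin T K \<and> countable_character_in T K)"

definition continuous_hom_onto ::
    "('a, 'm) monoid_scheme \<Rightarrow> 'a topology \<Rightarrow> ('b, 'n) monoid_scheme \<Rightarrow> 'b topology \<Rightarrow>
     ('a \<Rightarrow> 'b) \<Rightarrow> bool" where
  "continuous_hom_onto G T H S p \<longleftrightarrow>
     p \<in> hom G H \<and> continuous_map T S p \<and> p ` carrier G = carrier H"

definition perfect_hom ::
    "('a, 'm) monoid_scheme \<Rightarrow> 'a topology \<Rightarrow> ('b, 'n) monoid_scheme \<Rightarrow> 'b topology \<Rightarrow>
     ('a \<Rightarrow> 'b) \<Rightarrow> bool" where
  "perfect_hom G T H S p \<longleftrightarrow> p \<in> hom G H \<and> perfect_map T S p"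

text \<open>HOL cannot quantify existentially over the type of elements of \<open>H\<close>. In the next two
  definitions \<open>H\<close> therefore lives on \<open>'a set\<close>. This loses nothing, as every
  homomorphic image of \<open>G\<close> is isomorphic to one whose elements are subsets of \<open>G\<close> (fibres, that
  is, cosets of the kernel); lemmas \<open>M_factorizableI\<close> and \<open>PM_factorizableI\<close> below
  confirm that \<open>H\<close> may be taken on an arbitrary type.\<close>

definition M_factorizable :: "('a, 'm) monoid_scheme \<Rightarrow> 'a topology \<Rightarrow> bool" where
  "M_factorizable G T \<longleftrightarrow>
     (\<forall>f. continuous_map T euclideanreal f \<longrightarrow>
        (\<exists>(H :: 'a set monoid) S p g.
           topological_group H S \<and> metrizable_space S \<and> continuous_hom_onto G T H S p \<and>
           continuous_map S euclideanreal g \<and> (\<forall>x\<in>carrier G. f x = g (p x))))"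

definition PM_factorizable :: "('a, 'm) monoid_scheme \<Rightarrow> 'a topology \<Rightarrow> bool" where
  "PM_factorizable G T \<longleftrightarrow>
     (\<forall>f. continuous_map T euclideanreal f \<longrightarrow>
        (\<exists>(H :: 'a set monoid) S p g.
           topological_group H S \<and> metrizable_space S \<and> perfect_hom G T H S p \<and>
           continuous_map S euclideanreal g \<and> (\<forall>x\<in>carrier G. f x = g (p x))))"

lemma topological_group_transport:
  fixes H :: "('b, 'n) monoid_scheme" and S :: "'b topology" and e :: "'b \<Rightarrow> 'c"
  assumes H: "topological_group H S" and inj: "inj_on e (carrier H)"
  obtains H' :: "'c monoid" and S' d
  where "topological_group H' S'" "e \<in> iso H H'" "homeomorphic_maps S S' e d"
proof -
  interpret H: topological_group H S by (fact H)
  define d where "d = inv_into (carrier H) e"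
  define C where "C = e ` carrier H"
  define H' :: "'c monoid" where
    "H' = \<lparr>carrier = C, monoid.mult = (\<lambda>a b. e (d a \<otimes>\<^bsub>H\<^esub> d b)), one = e \<one>\<^bsub>H\<^esub>\<rparr>"
  define S' where "S' = pullback_topology C d S"
  have de [simp]: "d (e y) = y" if "y \<in> carrier H" for y
    using inj that by (simp add: d_def)
  have ed [simp]: "e (d a) = a" "d a \<in> carrier H" if "a \<in> C" for a
    using that by (auto simp: d_def C_def f_inv_into_f inv_into_into)
  have eC [simp]: "e y \<in> C" if "y \<in> carrier H" for y using that by (simp add: C_def)
  have car [simp]: "carrier H' = C" and mul [simp]: "a \<otimes>\<^bsub>H'\<^esub> b = e (d a \<otimes>\<^bsub>H\<^esub> d b)"
    and one [simp]: "\<one>\<^bsub>H'\<^esub> = e \<one>\<^bsub>H\<^esub>" for a b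
    by (simp_all add: H'_def)
  have grp: "group H'"
  proof (rule groupI)
    fix a assume a: "a \<in> carrier H'"
    show "\<exists>b\<in>carrier H'. b \<otimes>\<^bsub>H'\<^esub> a = \<one>\<^bsub>H'\<^esub>"
      by (rule bexI[of _ "e (inv\<^bsub>H\<^esub> (d a))"]) (use a in auto)
  qed (auto simp: H.m_assoc)
  interpret H': group H' by (fact grp)
  have inv': "inv\<^bsub>H'\<^esub> a = e (inv\<^bsub>H\<^esub> (d a))" if "a \<in> C" for a
    by (rule H'.inv_equality) (use that in auto)
  have top': "topspace S' = C"
    by (auto simp: S'_def topspace_pullback_topology H.topspace_eq_carrier)
  have d_cont: "continuous_map S' S d"
    using continuous_map_pullback[OF continuous_map_id[of S], where f = d and A = C]
    by (simp add: S'_def)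
  have e_cont: "continuous_map S S' e"
    unfolding S'_def
  proof (rule continuous_map_pullback')
    show "continuous_map S S (d \<circ> e)"
      by (rule continuous_map_eq[OF continuous_map_id]) (simp add: H.topspace_eq_carrier)
    show "topspace S \<subseteq> e -` C" by (auto simp: H.topspace_eq_carrier)
  qed
  have homeo: "homeomorphic_maps S S' e d"
    by (simp add: homeomorphic_maps_def e_cont d_cont top' H.topspace_eq_carrier)
  have iso: "e \<in> iso H H'"
    using inj by (auto simp: iso_def hom_def bij_betw_def C_def)
  have haus: "Hausdorff_space S'"
    using H.Hausdorff homeo homeomorphic_Hausdorff_space homeomorphic_space_def by blast
  have "continuous_map (prod_topology S' S') S' (e \<circ> (\<lambda>(x, y). x \<otimes>\<^bsub>H\<^esub> y) \<circ> (\<lambda>(a, b). (d a, d b)))"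
    by (intro continuous_map_compose[OF _ continuous_map_compose[OF H.continuous_mult e_cont]])
       (use d_cont in \<open>simp add: continuous_map_prod_top\<close>)
  then have "continuous_map (prod_topology S' S') S' (\<lambda>(a, b). a \<otimes>\<^bsub>H'\<^esub> b)"
    by (simp add: o_def case_prod_unfold)
  moreover have "continuous_map S' S' (\<lambda>a. inv\<^bsub>H'\<^esub> a)"
  proof (rule continuous_map_eq)
    show "continuous_map S' S' (e \<circ> (\<lambda>y. inv\<^bsub>H\<^esub> y) \<circ> d)"
      by (intro continuous_map_compose[OF d_cont continuous_map_compose[OF H.continuous_inv e_cont]])
  qed (simp add: top' inv')
  ultimately have "topological_group H' S'"
    by (simp add: topological_group_def topological_group_axioms_def grp top' haus)
  then show ?thesis using that iso homeo by blast
qed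

lemma factorization_transport:
  fixes G :: "('a, 'm) monoid_scheme" and H :: "('b, 'n) monoid_scheme"
  assumes H: "topological_group H S" "metrizable_space S"
    and p: "p \<in> hom G H" "p ` carrier G = carrier H" and T: "topspace T = carrier G"
    and g: "continuous_map S euclideanreal g" "\<forall>x\<in>carrier G. f x = g (p x)"
  obtains H' :: "'a set monoid" and S' e g'
  where "topological_group H' S'" "metrizable_space S'" "homeomorphic_map S S' e" "e \<in> iso H H'"
    "continuous_map S' euclideanreal g'" "\<forall>x\<in>carrier G. f x = g' ((e \<circ> p) x)"
proof -
  interpret H: topological_group H S by (fact H)
  define e where "e y = {x \<in> carrier G. p x = y}" for y
  have "inj_on e (carrier H)"
  proof (rule inj_onI)
    fix y z assume *: "y \<in> carrier H" "e y = e z"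
    then obtain x where "x \<in> carrier G" "p x = y" unfolding p(2)[symmetric] by blast
    with *(2) show "y = z" unfolding e_def by blast
  qed
  from topological_group_transport[OF H(1) this]
  obtain H' :: "'a set monoid" and S' d
    where e: "topological_group H' S'" "e \<in> iso H H'" "homeomorphic_maps S S' e d" .
  have "metrizable_space S'"
    using H(2) e(3) homeomorphic_metrizable_space homeomorphic_space_def by blast
  moreover have "homeomorphic_map S S' e" using e(3) homeomorphic_map_maps by blast
  moreover have "continuous_map S' euclideanreal (g \<circ> d)"
    using e(3) g(1) continuous_map_compose homeomorphic_maps_def by blast
  moreover have "\<forall>x\<in>carrier G. f x = (g \<circ> d) ((e \<circ> p) x)"
    using e(3) g(2) hom_in_carrier[OF p(1)]
    by (auto simp: homeomorphic_maps_def H.topspace_eq_carrier)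
  ultimately show ?thesis using that e(1,2) by blast
qed

lemma M_factorizableI:
  fixes G :: "('a, 'm) monoid_scheme"
  assumes G: "topological_group G T"
    and *: "\<And>f. continuous_map T euclideanreal f \<Longrightarrow>
        \<exists>(H :: ('b, 'n) monoid_scheme) S p g.
           topological_group H S \<and> metrizable_space S \<and> continuous_hom_onto G T H S p \<and>
           continuous_map S euclideanreal g \<and> (\<forall>x\<in>carrier G. f x = g (p x))"
  shows "M_factorizable G T"
  unfolding M_factorizable_def
proof (intro allI impI)
  fix f assume "continuous_map T euclideanreal f"
  from *[OF this] obtain H :: "('b, 'n) monoid_scheme" and S p g
    where H: "topological_group H S" "metrizable_space S"
      and p: "p \<in> hom G H" "continuous_map T S p" "p ` carrier G = carrier H"
      and g: "continuous_map S euclideanreal g" "\<forall>x\<in>carrier G. f x = g (p x)"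
    unfolding continuous_hom_onto_def by blast
  from factorization_transport[OF H p(1,3) topological_group.topspace_eq_carrier[OF G] g]
  obtain H' :: "'a set monoid" and S' e g'
    where e: "topological_group H' S'" "metrizable_space S'" "homeomorphic_map S S' e" "e \<in> iso H H'"
    "continuous_map S' euclideanreal g'" "\<forall>x\<in>carrier G. f x = g' ((e \<circ> p) x)" .
  have "e \<circ> p \<in> hom G H'"
    using p(1) e(4) by (auto simp: iso_def intro: hom_compose)
  moreover have "continuous_map T S' (e \<circ> p)"
    using p(2) e(3) continuous_map_compose homeomorphic_imp_continuous_map by blast
  moreover have "(e \<circ> p) ` carrier G = carrier H'"
    using p(3) e(4) by (metis (no_types, lifting) Group.iso_iff image_comp)
  ultimately have "continuous_hom_onto G T H' S' (e \<circ> p)"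
    by (simp add: continuous_hom_onto_def)
  then show "\<exists>(H :: 'a set monoid) S p g.
           topological_group H S \<and> metrizable_space S \<and> continuous_hom_onto G T H S p \<and>
           continuous_map S euclideanreal g \<and> (\<forall>x\<in>carrier G. f x = g (p x))"
    using e(1,2,5,6) by blast
qed

lemma PM_factorizableI:
  fixes G :: "('a, 'm) monoid_scheme"
  assumes G: "topological_group G T"
    and *: "\<And>f. continuous_map T euclideanreal f \<Longrightarrow>
        \<exists>(H :: ('b, 'n) monoid_scheme) S p g.
           topological_group H S \<and> metrizable_space S \<and> perfect_hom G T H S p \<and>
           continuous_map S euclideanreal g \<and> (\<forall>x\<in>carrier G. f x = g (p x))"
  shows "PM_factorizable G T"
  unfolding PM_factorizable_def
proof (intro allI impI)
  fix f assume "continuous_map T euclideanreal f"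
  from *[OF this] obtain H :: "('b, 'n) monoid_scheme" and S p g
    where H: "topological_group H S" "metrizable_space S"
      and p: "p \<in> hom G H" "perfect_map T S p"
      and g: "continuous_map S euclideanreal g" "\<forall>x\<in>carrier G. f x = g (p x)"
    unfolding perfect_hom_def by blast
  have onto: "p ` carrier G = carrier H"
    using p(2) topological_group.topspace_eq_carrier[OF G]
      topological_group.topspace_eq_carrier[OF H(1)] by (simp add: perfect_map_def)
  from factorization_transport[OF H p(1) onto topological_group.topspace_eq_carrier[OF G] g]
  obtain H' :: "'a set monoid" and S' e g'
    where e: "topological_group H' S'" "metrizable_space S'" "homeomorphic_map S S' e" "e \<in> iso H H'"
    "continuous_map S' euclideanreal g'" "\<forall>x\<in>carrier G. f x = g' ((e \<circ> p) x)" .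
  have "e \<circ> p \<in> hom G H'"
    using p(1) e(4) by (auto simp: iso_def intro: hom_compose)
  moreover have "perfect_map T S' (e \<circ> p)"
    using p(2) e(3) perfect_map_compose homeomorphic_imp_perfect_map by blast
  ultimately have "perfect_hom G T H' S' (e \<circ> p)"
    by (simp add: perfect_hom_def)
  then show "\<exists>(H :: 'a set monoid) S p g.
           topological_group H S \<and> metrizable_space S \<and> perfect_hom G T H S p \<and>
           continuous_map S euclideanreal g \<and> (\<forall>x\<in>carrier G. f x = g (p x))"
    using e(1,2,5,6) by blast
qed

end

theory Submission
  imports Defs "HOL-Algebra.Product_Groups"
begin

text \<open>A perfect homomorphism onto a metrizable group has a compact kernel, and pulling back a
  countable neighbourhood base at the identity shows that the kernel has countable character.
  Conversely, let \<open>K\<close> be compact with a countable base \<open>U n\<close> of neighbourhoods, and let \<open>h n\<close> be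
  continuous, \<open>0\<close> on \<open>K\<close> and \<open>1\<close> off \<open>U n\<close>. Factor \<open>f\<close> and all the \<open>h n\<close> simultaneously through
  one continuous homomorphism \<open>p\<close> into a countable product of metrizable groups. For \<open>k \<in> K\<close> the
  fibre of \<open>p k\<close> lies in every \<open>U n\<close>, hence in \<open>K\<close>, and is compact. Since each \<open>U n\<close> contains the
  preimage of a neighbourhood of \<open>p k\<close>, neighbourhoods of this fibre contain such preimages too;
  by translation the same holds at all points, so \<open>p\<close> is perfect.\<close>

section \<open>The Birkhoff--Kakutani gauge of a chain of neighbourhoods\<close>

text \<open>The entry at which the partial sums first exceed half the total leaves at most half on
  either side. Positivity puts the total strictly above its own half, so there is such an
  entry.\<close>

lemma sum_list_halve:
  fixes xs :: "real list"
  assumes "xs \<noteq> []" "\<And>x. x \<in> set xs \<Longrightarrow> 0 < x"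
  obtains as x bs where "xs = as @ x # bs" "sum_list as \<le> sum_list xs / 2" "sum_list bs \<le> sum_list xs / 2"
proof -
  \<comment> \<open>The threshold \<open>t\<close> varies in the induction, as passing the head
    \<open>y\<close> lowers it to \<open>t - y\<close>.\<close>
  have split: "\<exists>as x bs. ys = as @ x # bs \<and> sum_list as \<le> t \<and> t < sum_list as + x"
    if "0 \<le> t" "t < sum_list ys" for t :: real and ys
    using that
  proof (induction ys arbitrary: t)
    case Nil
    then show ?case by simp
  next
    case (Cons y ys)
    show ?case
    proof (cases "t < y")
      case True
      then show ?thesis using Cons.prems by (intro exI[of _ "[]"]) auto
    next
      case False
      then obtain as x bs where "ys = as @ x # bs" "sum_list as \<le> t - y" "t - y < sum_list as + x"
        using Cons.IH[of "t - y"] Cons.prems by auto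
      then show ?thesis by (intro exI[of _ "y # as"] exI[of _ x] exI[of _ bs]) auto
    qed
  qed
  have "0 < sum_list xs"
    using assms by (cases xs) (auto simp: less_imp_le intro!: add_pos_nonneg sum_list_nonneg)
  then obtain as x bs where "xs = as @ x # bs" "sum_list as \<le> sum_list xs / 2" "sum_list xs / 2 < sum_list as + x"
    using split[of "sum_list xs / 2" xs] by auto
  then show ?thesis using that by fastforce
qed

text \<open>The Birkhoff--Kakutani construction: with \<open>V (Suc n)\<close> cubed inside \<open>V n\<close>, the infimum of
  \<open>(1/2)^n1 + ... + (1/2)^nk\<close> over all ways to write \<open>x\<close> as a product of elements of
  \<open>V n1, ..., V nk\<close> is a function small exactly near the identity. Starting at \<open>V 0 = G\<close> ensures
  that the infimum is never over the empty set.\<close>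

locale cube_chain = group G for G (structure) +
  fixes V :: "nat \<Rightarrow> 'a set"
  assumes V_0: "V 0 = carrier G"
    and V_subset: "V n \<subseteq> carrier G"
    and one_in_V: "\<one> \<in> V n"
    and inv_in_V: "x \<in> V n \<Longrightarrow> inv x \<in> V n"
    and cube_in_V: "\<lbrakk>x \<in> V (Suc n); y \<in> V (Suc n); z \<in> V (Suc n)\<rbrakk> \<Longrightarrow> x \<otimes> (y \<otimes> z) \<in> V n"
begin

text \<open>Letters carry their level, because an element may lie in several sets \<open>V n\<close>
  and its cost depends on the level charged for it.\<close>

definition wprod :: "(nat \<times> 'a) list \<Rightarrow> 'a" where
  "wprod ws = foldr (\<lambda>(n, x) y. x \<otimes> y) ws \<one>"

definition cost :: "(nat \<times> 'a) list \<Rightarrow> real" where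
  "cost ws = sum_list (map (\<lambda>(n, x). (1/2) ^ n) ws)"

definition wds :: "(nat \<times> 'a) list set" where
  "wds = {ws. \<forall>(n, x) \<in> set ws. x \<in> V n}"

definition gauge :: "'a \<Rightarrow> real" where
  "gauge x = (INF ws\<in>{ws \<in> wds. wprod ws = x}. cost ws)"

lemma wds_simps [simp]:
  "[] \<in> wds" "(n, x) # ws \<in> wds \<longleftrightarrow> x \<in> V n \<and> ws \<in> wds"
  "us @ vs \<in> wds \<longleftrightarrow> us \<in> wds \<and> vs \<in> wds"
  by (auto simp: wds_def)

lemma cost_simps [simp]:
  "cost [] = 0" "cost ((n, x) # ws) = (1/2) ^ n + cost ws" "cost (us @ vs) = cost us + cost vs"
  by (auto simp: cost_def)

lemma cost_nonneg: "0 \<le> cost ws"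
  by (auto simp: cost_def intro!: sum_list_nonneg)

lemma wprod_simps [simp]: "wprod [] = \<one>" "wprod ((n, x) # ws) = x \<otimes> wprod ws"
  by (auto simp: wprod_def)

lemma V_carrier [simp]: "x \<in> V n \<Longrightarrow> x \<in> carrier G"
  using V_subset by blast

lemma wprod_carrier [simp]: "ws \<in> wds \<Longrightarrow> wprod ws \<in> carrier G"
  by (induction ws) auto

lemma wprod_append: "\<lbrakk>us \<in> wds; vs \<in> wds\<rbrakk> \<Longrightarrow> wprod (us @ vs) = wprod us \<otimes> wprod vs"
  by (induction us) (auto simp: m_assoc)

lemma V_antimono: "m \<le> n \<Longrightarrow> V n \<subseteq> V m"
proof (rule lift_Suc_antimono_le[of V])
  fix n show "V (Suc n) \<subseteq> V n"
    using cube_in_V[of _ n \<one> \<one>] one_in_V by fastforce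
qed

text \<open>Induction on the length of the word. The outer parts around a middle letter cost less
  than \<open>(1/2) ^ Suc m\<close>, and the letter, costing less than \<open>(1/2) ^ m\<close>, has
  level at least \<open>Suc m\<close>. So all three factors lie in \<open>V (Suc m)\<close>; this is
  why the chain is built with cubes rather than squares.\<close>

lemma wprod_in_V: "\<lbrakk>ws \<in> wds; cost ws < (1/2) ^ m\<rbrakk> \<Longrightarrow> wprod ws \<in> V m"
proof (induction ws arbitrary: m rule: length_induct)
  case (1 ws)
  show ?case
  proof (cases "ws = []")
    case True
    then show ?thesis by (simp add: one_in_V)
  next
    case False
    define c where "c = (\<lambda>(n :: nat, x :: 'a). (1/2 :: real) ^ n)"
    have cost: "cost us = sum_list (map c us)" for us by (simp add: cost_def c_def)
    \<comment> \<open>Splitting at the middle of the cost leaves two words of cost below \<open>(1/2)^(m+1)\<close> around one letter.\<close>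
    obtain as r bs where s: "map c ws = as @ r # bs" "sum_list as \<le> cost ws / 2" "sum_list bs \<le> cost ws / 2"
    proof (rule sum_list_halve[of "map c ws"])
      show "map c ws \<noteq> []" using False by simp
    qed (auto simp: cost c_def)
    then obtain us w vs where ws: "ws = us @ w # vs" "map c us = as" "map c vs = bs"
      by (auto simp: map_eq_append_conv map_eq_Cons_conv)
    obtain n x where w: "w = (n, x)" by (cases w)
    have "cost us < (1/2) ^ Suc m" "cost vs < (1/2) ^ Suc m"
      using s(2,3) 1(3) by (auto simp: cost ws(2,3))
    then have uv: "wprod us \<in> V (Suc m)" "wprod vs \<in> V (Suc m)"
      using 1(1,2) by (auto simp: ws(1) w)
    have "cost us + ((1/2) ^ n + cost vs) < (1/2) ^ m"
      using 1(3) by (simp add: ws(1) w)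
    then have "(1/2 :: real) ^ n < (1/2) ^ m"
      using cost_nonneg[of us] cost_nonneg[of vs] by linarith
    then have "Suc m \<le> n"
      using power_decreasing[of n m "1/2 :: real"] by (cases "n \<le> m") auto
    then have "x \<in> V (Suc m)"
      using V_antimono 1(2) by (auto simp: ws(1) w)
    with uv have "wprod us \<otimes> (x \<otimes> wprod vs) \<in> V m" by (intro cube_in_V)
    then show ?thesis using 1(2) by (simp add: ws(1) w wprod_append)
  qed
qed

lemma wds_nonempty: "x \<in> carrier G \<Longrightarrow> {ws \<in> wds. wprod ws = x} \<noteq> {}"
proof -
  assume "x \<in> carrier G"
  then have "[(0, x)] \<in> {ws \<in> wds. wprod ws = x}" by (simp add: V_0)
  then show ?thesis by blast
qed

lemma cost_bdd_below: "bdd_below (cost ` A)"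
  by (rule bdd_belowI2[of _ 0]) (rule cost_nonneg)

lemma gauge_le: "ws \<in> wds \<Longrightarrow> gauge (wprod ws) \<le> cost ws"
  unfolding gauge_def by (rule cINF_lower) (auto intro: cost_bdd_below)

lemma gauge_one: "gauge \<one> = 0"
proof (rule antisym)
  show "gauge \<one> \<le> 0" using gauge_le[of "[]"] by simp
  show "0 \<le> gauge \<one>"
    unfolding gauge_def by (intro cINF_greatest wds_nonempty) (auto simp: cost_nonneg)
qed

text \<open>By \<open>wprod_in_V\<close>, no word for an element outside \<open>V m\<close> costs
  less than \<open>(1/2) ^ m\<close>. So the gauge separates the identity from the complement of
  \<open>V m\<close>.\<close>

lemma gauge_ge: "x \<in> carrier G \<Longrightarrow> x \<notin> V m \<Longrightarrow> (1/2) ^ m \<le> gauge x"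
  unfolding gauge_def by (intro cINF_greatest wds_nonempty) (use wprod_in_V not_less in blast)+

lemma gauge_mult_le: "\<lbrakk>x \<in> carrier G; y \<in> V n\<rbrakk> \<Longrightarrow> gauge (x \<otimes> y) \<le> gauge x + (1/2) ^ n"
proof -
  assume x: "x \<in> carrier G" and y: "y \<in> V n"
  have "gauge (x \<otimes> y) - (1/2) ^ n \<le> gauge x"
    unfolding gauge_def[of x]
  proof (rule cINF_greatest[OF wds_nonempty[OF x]])
    fix ws assume ws: "ws \<in> {ws \<in> wds. wprod ws = x}"
    then have "gauge (x \<otimes> y) \<le> cost (ws @ [(n, y)])"
      using gauge_le[of "ws @ [(n, y)]"] y by (simp add: wprod_append)
    then show "gauge (x \<otimes> y) - (1/2) ^ n \<le> cost ws" by simp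
  qed
  then show ?thesis by simp
qed

text \<open>The other half of the bound comes from cancelling \<open>y\<close> with
  \<open>inv y\<close>, which lies in \<open>V n\<close> too. As the bound does not depend on
  \<open>x\<close>, it yields continuity of the gauge.\<close>

lemma gauge_diff_le:
  assumes x: "x \<in> carrier G" and y: "y \<in> V n"
  shows "\<bar>gauge (x \<otimes> y) - gauge x\<bar> \<le> (1/2) ^ n"
  using gauge_mult_le[OF x y] gauge_mult_le[of "x \<otimes> y" "inv y" n] x y
  by (simp add: inv_in_V m_assoc)

end

section \<open>Neighbourhoods of the identity and complete regularity\<close>

context topological_group
begin

lemma continuous_map_mult:
  assumes "continuous_map X T f" "continuous_map X T g"
  shows "continuous_map X T (\<lambda>x. f x \<otimes> g x)"
  using continuous_map_compose[OF _ continuous_mult, of X "\<lambda>x. (f x, g x)"] assms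
  by (simp add: continuous_map_pairedI o_def)

lemma continuous_map_inverse: "continuous_map X T f \<Longrightarrow> continuous_map X T (\<lambda>x. inv (f x))"
  using continuous_map_compose[OF _ continuous_inv, of X f] by (simp add: o_def)

lemma continuous_map_left_mult: "a \<in> carrier G \<Longrightarrow> continuous_map T T (\<lambda>x. a \<otimes> x)"
  by (intro continuous_map_mult) (auto simp: topspace_eq_carrier)

lemma openin_left_preimage:
  assumes "openin T U" "a \<in> carrier G"
  shows "openin T {x \<in> carrier G. a \<otimes> x \<in> U}"
  using openin_continuous_map_preimage[OF continuous_map_left_mult[OF assms(2)] assms(1)]
  by (simp add: topspace_eq_carrier)

text \<open>Continuity of multiplication at the identity, used twice, gives \<open>A\<close> with
  products of two elements in \<open>V\<close> and \<open>B\<close> with products of two elements in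
  \<open>A\<close>. Intersecting \<open>A \<inter> B\<close> with its preimage under inversion makes
  it symmetric.\<close>

lemma cube_neighbourhood:
  assumes V: "openin T V" "\<one> \<in> V"
  obtains W where "openin T W" "\<one> \<in> W" "\<And>x. x \<in> W \<Longrightarrow> inv x \<in> W"
    "\<And>x y z. \<lbrakk>x \<in> W; y \<in> W; z \<in> W\<rbrakk> \<Longrightarrow> x \<otimes> (y \<otimes> z) \<in> V"
proof -
  have square: "\<exists>B. openin T B \<and> \<one> \<in> B \<and> (\<forall>x\<in>B. \<forall>y\<in>B. x \<otimes> y \<in> A)" if A: "openin T A" "\<one> \<in> A" for A
  proof -
    define M where "M = {z \<in> topspace (prod_topology T T). (case z of (x, y) \<Rightarrow> x \<otimes> y) \<in> A}"
    have "openin (prod_topology T T) M"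
      unfolding M_def by (rule openin_continuous_map_preimage[OF continuous_mult A(1)])
    moreover have "(\<one>, \<one>) \<in> M"
      using A by (simp add: M_def topspace_eq_carrier)
    ultimately obtain C D where "openin T C" "openin T D" "\<one> \<in> C" "\<one> \<in> D" "C \<times> D \<subseteq> M"
      unfolding openin_prod_topology_alt by meson
    moreover from this have "\<forall>x\<in>C \<inter> D. \<forall>y\<in>C \<inter> D. x \<otimes> y \<in> A"
      by (fastforce simp: M_def)
    ultimately show ?thesis by (intro exI[of _ "C \<inter> D"]) (simp add: openin_Int)
  qed
  obtain A where A: "openin T A" "\<one> \<in> A" "\<And>x y. x \<in> A \<Longrightarrow> y \<in> A \<Longrightarrow> x \<otimes> y \<in> V"
    using square[OF V] by metis
  obtain B where B: "openin T B" "\<one> \<in> B" "\<And>x y. x \<in> B \<Longrightarrow> y \<in> B \<Longrightarrow> x \<otimes> y \<in> A"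
    using square[OF A(1,2)] by metis
  define C where "C = A \<inter> B"
  define W where "W = C \<inter> {x \<in> topspace T. inv x \<in> C}"
  have C: "openin T C" "C \<subseteq> carrier G"
    using A(1) B(1) openin_subset topspace_eq_carrier by (fastforce simp: C_def)+
  show ?thesis
  proof (rule that)
    show "openin T W"
      unfolding W_def by (intro openin_Int C openin_continuous_map_preimage[OF continuous_inv])
    show "\<one> \<in> W" using A B by (simp add: W_def C_def topspace_eq_carrier)
    show "inv x \<in> W" if "x \<in> W" for x
      using that C by (auto simp: W_def topspace_eq_carrier)
    show "x \<otimes> (y \<otimes> z) \<in> V" if "x \<in> W" "y \<in> W" "z \<in> W" for x y z
      using that A B by (simp add: W_def C_def)
  qed
qed

lemma cube_chain_exists:
  assumes U: "openin T U" "\<one> \<in> U"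
  obtains V where "cube_chain G V" "\<And>n. openin T (V n)" "V (Suc 0) \<subseteq> U"
proof -
  define P where "P n W \<longleftrightarrow> openin T W \<and> \<one> \<in> W \<and> (\<forall>x\<in>W. inv x \<in> W) \<and> (n = 0 \<longrightarrow> W = carrier G)"
    for n :: nat and W
  \<comment> \<open>\<open>Q\<close> relates consecutive sets. It records \<open>U\<close> at index
    0 only: \<open>V 0\<close> is the whole group, so \<open>V (Suc 0)\<close> is the first set that
    can be asked to lie in \<open>U\<close>.\<close>
  define Q where "Q n V W \<longleftrightarrow> (\<forall>x\<in>W. \<forall>y\<in>W. \<forall>z\<in>W. x \<otimes> (y \<otimes> z) \<in> V) \<and> (n = 0 \<longrightarrow> W \<subseteq> U)"
    for n :: nat and V W
  have "\<exists>V. \<forall>n. P n (V n) \<and> Q n (V n) (V (Suc n))"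
  proof (rule dependent_nat_choice)
    show "\<exists>W. P 0 W"
      unfolding P_def using openin_topspace[of T] by (intro exI[of _ "carrier G"]) (simp add: topspace_eq_carrier)
    fix V and n :: nat
    assume "P n V"
    then have "openin T (V \<inter> U)" "\<one> \<in> V \<inter> U" using U by (auto simp: P_def)
    then obtain W where W: "openin T W" "\<one> \<in> W" "\<And>x. x \<in> W \<Longrightarrow> inv x \<in> W"
      "\<And>x y z. \<lbrakk>x \<in> W; y \<in> W; z \<in> W\<rbrakk> \<Longrightarrow> x \<otimes> (y \<otimes> z) \<in> V \<inter> U"
      by (rule cube_neighbourhood) blast
    moreover have "W \<subseteq> U"
    proof
      fix x assume x: "x \<in> W"
      then have "x \<in> carrier G" using W(1) openin_subset topspace_eq_carrier by blast
      then show "x \<in> U" using W(4)[OF x W(2) W(2)] by simp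
    qed
    ultimately show "\<exists>W. P (Suc n) W \<and> Q n V W" unfolding P_def Q_def by blast
  qed
  then obtain V where V: "\<And>n. P n (V n)" "\<And>n. Q n (V n) (V (Suc n))" by blast
  have "cube_chain G V"
  proof
    show "V n \<subseteq> carrier G" for n
      using V(1)[of n] openin_subset topspace_eq_carrier by (auto simp: P_def)
  qed (use V in \<open>simp_all add: P_def Q_def\<close>)
  then show ?thesis using that V by (simp add: P_def Q_def)
qed

text \<open>The gauge of a chain inside the translate of \<open>S\<close> to the identity, moved
  back to \<open>a\<close>, separates \<open>a\<close> from the complement of \<open>S\<close>. This
  supplies the Urysohn functions for compact sets used later.\<close>

lemma completely_regular: "completely_regular_space T"
  unfolding completely_regular_space_alt'
proof (intro allI impI)
  fix S a assume S: "openin T S" "a \<in> S"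
  then have a: "a \<in> carrier G" using openin_subset topspace_eq_carrier by blast
  obtain V where V: "cube_chain G V" "\<And>n. openin T (V n)" "V (Suc 0) \<subseteq> {x \<in> carrier G. a \<otimes> x \<in> S}"
    by (rule cube_chain_exists[OF openin_left_preimage[OF S(1) a]]) (use S a in auto)
  interpret cube_chain G V by (fact V)
  have "continuous_map T euclideanreal gauge"
    unfolding mtopology_is_euclidean[symmetric] Met_TC.continuous_map_to_metric topspace_eq_carrier
  proof (intro ballI allI impI)
    fix x and e :: real
    assume x: "x \<in> carrier G" and "0 < e"
    then obtain n where n: "(1/2) ^ n < e" using real_arch_pow_inv[of e "1/2"] by auto
    \<comment> \<open>The left translate of \<open>V n\<close> by \<open>x\<close>: its points are
      \<open>x\<close> times an element of \<open>V n\<close>, as \<open>gauge_diff_le\<close>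
      requires.\<close>
    let ?U = "{y \<in> carrier G. inv x \<otimes> y \<in> V n}"
    have "gauge y \<in> Met_TC.mball (gauge x) e" if "y \<in> ?U" for y
      using gauge_diff_le[OF x, of "inv x \<otimes> y" n] that x n
      by (simp add: m_assoc[symmetric] dist_real_def abs_minus_commute)
    then show "\<exists>U. openin T U \<and> x \<in> U \<and> (\<forall>y\<in>U. gauge y \<in> Met_TC.mball (gauge x) e)"
      using openin_left_preimage[OF V(2), of "inv x" n] x one_in_V by (intro exI[of _ ?U]) auto
  qed
  \<comment> \<open>Off \<open>S\<close> the translated gauge is at least \<open>1/2\<close>, since
    \<open>inv a \<otimes> x\<close> misses \<open>V (Suc 0)\<close>. Doubling and cutting off at 1
    makes the value there exactly 1.\<close>
  from continuous_map_compose[OF continuous_map_left_mult this, of "inv a"] a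
  have "continuous_map T euclideanreal (\<lambda>x. min 1 (2 * gauge (inv a \<otimes> x)))"
    by (intro continuous_map_real_min continuous_map_real_mult_left) (auto simp: o_def)
  moreover have "2 * gauge (inv a \<otimes> x) \<ge> 1" if "x \<in> carrier G - S" for x
  proof -
    have "inv a \<otimes> x \<notin> V (Suc 0)" using V(3) that a by (auto simp: m_assoc[symmetric])
    then show ?thesis using gauge_ge[of "inv a \<otimes> x" "Suc 0"] that a by simp
  qed
  moreover have "min 1 (2 * gauge (inv a \<otimes> a)) = 0" using a by (simp add: gauge_one)
  ultimately show "\<exists>f. continuous_map T euclideanreal f \<and> f a = 0 \<and> f ` (topspace T - S) \<subseteq> {1}"
    by (intro exI[of _ "\<lambda>x. min 1 (2 * gauge (inv a \<otimes> x))"])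
      (simp add: image_subset_iff topspace_eq_carrier)
qed

section \<open>Subgroups and products of topological groups\<close>

lemma topological_subgroup:
  assumes "subgroup K G"
  shows "topological_group (G\<lparr>carrier := K\<rparr>) (subtopology T K)"
proof (intro topological_group.intro topological_group_axioms.intro)
  let ?K = "G\<lparr>carrier := K\<rparr>" and ?T = "subtopology T K"
  show "group ?K" by (rule subgroup_imp_group[OF assms])
  show "topspace ?T = carrier ?K"
    using subgroup.subset[OF assms] by (auto simp: topspace_eq_carrier)
  show "Hausdorff_space ?T" by (rule Hausdorff_space_subtopology[OF Hausdorff])
  have "continuous_map (prod_topology ?T ?T) T (\<lambda>z. fst z \<otimes> snd z)"
    by (intro continuous_map_mult continuous_map_into_fulltopology[OF continuous_map_fst]
        continuous_map_into_fulltopology[OF continuous_map_snd])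
  then show "continuous_map (prod_topology ?T ?T) ?T (\<lambda>(x, y). x \<otimes>\<^bsub>?K\<^esub> y)"
    using subgroup.m_closed[OF assms]
    by (auto simp: continuous_map_in_subtopology case_prod_unfold)
  have "continuous_map ?T T (\<lambda>x. inv x)"
    by (intro continuous_map_inverse continuous_map_from_subtopology) simp
  then have "continuous_map ?T ?T (\<lambda>x. inv x)"
    using subgroup.m_inv_closed[OF assms] by (auto simp: continuous_map_in_subtopology)
  then show "continuous_map ?T ?T (\<lambda>x. inv\<^bsub>?K\<^esub> x)"
    by (rule continuous_map_eq) (simp add: m_inv_consistent[OF assms])
qed

end

lemma topological_product_group:
  assumes G: "\<And>i. i \<in> I \<Longrightarrow> topological_group (G i) (T i)"
  shows "topological_group (product_group I G) (product_topology T I)"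
proof (intro topological_group.intro topological_group_axioms.intro)
  let ?G = "product_group I G" and ?T = "product_topology T I"
  have grp: "group (G i)" if "i \<in> I" for i using G[OF that] by (simp add: topological_group_def)
  then show "group ?G" by simp
  show top: "topspace ?T = carrier ?G"
    unfolding topspace_product_topology carrier_product_group
    by (intro PiE_cong topological_group.topspace_eq_carrier G)
  show "Hausdorff_space ?T"
    unfolding Hausdorff_space_product_topology using topological_group.Hausdorff[OF G] by blast
  have proj: "continuous_map ?T (T i) (\<lambda>x. x i)" if "i \<in> I" for i
    using continuous_map_product_projection[OF that] .
  have "continuous_map (prod_topology ?T ?T) (T i) (\<lambda>z. fst z i \<otimes>\<^bsub>G i\<^esub> snd z i)" if "i \<in> I" for i
  proof -
    have "continuous_map (prod_topology ?T ?T) (T i) (\<lambda>z. fst z i)"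
      using continuous_map_compose[OF continuous_map_fst[of ?T ?T] proj[OF that]] by (simp add: o_def)
    moreover have "continuous_map (prod_topology ?T ?T) (T i) (\<lambda>z. snd z i)"
      using continuous_map_compose[OF continuous_map_snd[of ?T ?T] proj[OF that]] by (simp add: o_def)
    ultimately show ?thesis
      by (rule topological_group.continuous_map_mult[OF G[OF that]])
  qed
  then show "continuous_map (prod_topology ?T ?T) ?T (\<lambda>(x, y). x \<otimes>\<^bsub>?G\<^esub> y)"
    by (simp add: continuous_map_componentwise case_prod_unfold image_subset_iff cong: restrict_cong)
  have "continuous_map ?T (T i) (\<lambda>x. inv\<^bsub>G i\<^esub> x i)" if "i \<in> I" for i
    by (rule topological_group.continuous_map_inverse[OF G[OF that] proj[OF that]])
  then have "continuous_map ?T ?T (\<lambda>x. \<lambda>i\<in>I. inv\<^bsub>G i\<^esub> x i)"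
    by (simp add: continuous_map_componentwise image_subset_iff)
  then show "continuous_map ?T ?T (\<lambda>x. inv\<^bsub>?G\<^esub> x)"
    by (rule continuous_map_eq) (use top grp in \<open>simp add: inv_product_group\<close>)
qed

section \<open>Simultaneous factorization of countably many functions\<close>

text \<open>The diagonal of the single factorizations maps into a countable product, which is again
  metrizable; restricting to its image makes it onto. The product lives on
  \<open>nat \<Rightarrow> 'a set\<close>, a change of type that \<open>PM_factorizableI\<close>
  absorbs later.\<close>

lemma M_factorizable_countable_family:
  fixes G :: "('a, 'm) monoid_scheme" and f :: "nat \<Rightarrow> 'a \<Rightarrow> real"
  assumes G: "topological_group G T" and M: "M_factorizable G T"
    and f: "\<And>n. continuous_map T euclideanreal (f n)"
  shows "\<exists>(H :: (nat \<Rightarrow> 'a set) monoid) S p g.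
    topological_group H S \<and> metrizable_space S \<and> continuous_hom_onto G T H S p \<and>
    (\<forall>n. continuous_map S euclideanreal (g n)) \<and> (\<forall>n. \<forall>x\<in>carrier G. f n x = g n (p x))"
proof -
  interpret G: topological_group G T by (fact G)
  have "\<forall>n. \<exists>(H :: 'a set monoid) S p g.
           topological_group H S \<and> metrizable_space S \<and> continuous_hom_onto G T H S p \<and>
           continuous_map S euclideanreal g \<and> (\<forall>x\<in>carrier G. f n x = g (p x))"
    using M f unfolding M_factorizable_def by blast
  then obtain H :: "nat \<Rightarrow> 'a set monoid" and S p g
    where H: "\<And>n. topological_group (H n) (S n)" "\<And>n. metrizable_space (S n)"
      and p: "\<And>n. p n \<in> hom G (H n)" "\<And>n. continuous_map T (S n) (p n)"
      and g: "\<And>n. continuous_map (S n) euclideanreal (g n)" "\<And>n x. x \<in> carrier G \<Longrightarrow> f n x = g n (p n x)"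
    unfolding continuous_hom_onto_def by metis
  let ?P = "product_group UNIV H" and ?S = "product_topology S UNIV"
  define q where "q x = (\<lambda>n. p n x)" for x
  define C where "C = q ` carrier G"
  interpret P: topological_group ?P ?S by (rule topological_product_group) (rule H)
  have q_hom: "q \<in> hom G ?P"
    using hom_in_carrier[OF p(1)] hom_mult[OF p(1)] by (intro homI) (auto simp: q_def)
  have "group_hom G ?P q"
    by (intro group_hom.intro group_hom_axioms.intro q_hom G.is_group P.is_group)
  then have C: "subgroup C ?P"
    unfolding C_def by (rule group_hom.img_is_subgroup)
  show ?thesis
  proof (intro exI conjI allI ballI)
    show "topological_group (?P\<lparr>carrier := C\<rparr>) (subtopology ?S C)"
      by (rule P.topological_subgroup[OF C])
    show "metrizable_space (subtopology ?S C)"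
      using H(2) by (intro metrizable_space_subtopology) (simp add: metrizable_space_product_topology)
    have "continuous_map T ?S q"
      using p(2) by (simp add: continuous_map_componentwise_UNIV q_def)
    then show "continuous_hom_onto G T (?P\<lparr>carrier := C\<rparr>) (subtopology ?S C) q"
      using q_hom by (auto simp: continuous_hom_onto_def continuous_map_in_subtopology hom_def C_def
          G.topspace_eq_carrier)
    show "continuous_map (subtopology ?S C) euclideanreal (\<lambda>y. g n (y n))" for n
      using continuous_map_compose[OF continuous_map_product_projection[of n UNIV S] g(1)[of n]]
      by (simp add: o_def continuous_map_from_subtopology)
    show "f n x = g n (q x n)" if "x \<in> carrier G" for n x
      using g(2) that by (simp add: q_def)
  qed
qed

section \<open>Neighbourhood sequences and perfectness from a single fibre\<close>

text \<open>The whole space is open and contains \<open>K\<close>, so the family is non-empty and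
  \<open>from_nat_into\<close> enumerates exactly its members.\<close>

lemma countable_character_in_sequence:
  assumes "countable_character_in T K" "K \<subseteq> topspace T"
  shows "\<exists>U :: nat \<Rightarrow> 'a set. (\<forall>n. openin T (U n) \<and> K \<subseteq> U n) \<and>
    (\<forall>V. openin T V \<and> K \<subseteq> V \<longrightarrow> (\<exists>n. U n \<subseteq> V))"
proof -
  obtain \<U> where U: "countable \<U>" "\<forall>U\<in>\<U>. openin T U \<and> K \<subseteq> U"
    "\<forall>V. openin T V \<and> K \<subseteq> V \<longrightarrow> (\<exists>U\<in>\<U>. U \<subseteq> V)"
    using assms(1) unfolding countable_character_in_def by (elim exE conjE)
  have "\<U> \<noteq> {}" using U(3)[rule_format, of "topspace T"] assms(2) by auto
  then have "range (from_nat_into \<U>) = \<U>" using U(1) by (rule range_from_nat_into)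
  then show ?thesis
    using U(2,3) by (intro exI[of _ "from_nat_into \<U>"]) (metis rangeE rangeI)
qed

text \<open>All fibres are left translates of the one over \<open>p k\<close>, so its compactness
  and closedness of \<open>p\<close> at it spread to every fibre. A map is closed once this holds at
  each fibre.\<close>

lemma perfect_homI:
  assumes G: "topological_group G T" and H: "topological_group H S"
    and p: "continuous_hom_onto G T H S p" and k: "k \<in> carrier G"
    and compact_fibre: "compactin T {x \<in> carrier G. p x = p k}"
    and closed_at: "\<And>V. \<lbrakk>openin T V; {x \<in> carrier G. p x = p k} \<subseteq> V\<rbrakk> \<Longrightarrow>
          \<exists>W. openin S W \<and> p k \<in> W \<and> {x \<in> carrier G. p x \<in> W} \<subseteq> V"
  shows "perfect_hom G T H S p"
proof -
  interpret G: topological_group G T by (fact G)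
  interpret H: topological_group H S by (fact H)
  have hom: "p \<in> hom G H" and cont: "continuous_map T S p" and onto: "p ` carrier G = carrier H"
    using p by (auto simp: continuous_hom_onto_def)
  interpret group_hom G H p
    by (intro group_hom.intro group_hom_axioms.intro hom G.is_group H.is_group)
  have cancel: "b \<otimes>\<^bsub>G\<^esub> (inv\<^bsub>G\<^esub> b \<otimes>\<^bsub>G\<^esub> x) = x" "inv\<^bsub>G\<^esub> b \<otimes>\<^bsub>G\<^esub> (b \<otimes>\<^bsub>G\<^esub> x) = x"
    if "b \<in> carrier G" "x \<in> carrier G" for b x
    using that by (simp_all add: G.m_assoc[symmetric])
  \<comment> \<open>Left multiplication by \<open>k \<otimes> inv a\<close> is the inverse
    translation and provides the preimages.\<close>
  have fibre: "{x \<in> carrier G. p x = p a} = (\<lambda>x. (a \<otimes>\<^bsub>G\<^esub> inv\<^bsub>G\<^esub> k) \<otimes>\<^bsub>G\<^esub> x) ` {x \<in> carrier G. p x = p k}"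
    (is "_ = ?t ` _") if a: "a \<in> carrier G" for a
  proof (intro equalityI subsetI)
    fix x assume "x \<in> {x \<in> carrier G. p x = p a}"
    then have "x = ?t ((k \<otimes>\<^bsub>G\<^esub> inv\<^bsub>G\<^esub> a) \<otimes>\<^bsub>G\<^esub> x)" "(k \<otimes>\<^bsub>G\<^esub> inv\<^bsub>G\<^esub> a) \<otimes>\<^bsub>G\<^esub> x \<in> {x \<in> carrier G. p x = p k}"
      using a k by (simp_all add: G.m_assoc H.m_assoc cancel)
    then show "x \<in> ?t ` {x \<in> carrier G. p x = p k}" by blast
  qed (use a k in \<open>auto simp: H.m_assoc\<close>)
  have "\<exists>W. openin S W \<and> y \<in> W \<and> {x \<in> topspace T. p x \<in> W} \<subseteq> U"
    if U: "openin T U" "{x \<in> topspace T. p x = y} \<subseteq> U" and "y \<in> topspace S" for U y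
  proof -
    have "y \<in> p ` carrier G" using \<open>y \<in> topspace S\<close> by (simp add: onto H.topspace_eq_carrier)
    then obtain a where a: "a \<in> carrier G" "y = p a" by blast
    define b where "b = a \<otimes>\<^bsub>G\<^esub> inv\<^bsub>G\<^esub> k"
    have b: "b \<in> carrier G" using a k by (simp add: b_def)
    have "{x \<in> carrier G. p x = p k} \<subseteq> {x \<in> carrier G. b \<otimes>\<^bsub>G\<^esub> x \<in> U}"
      using U(2) fibre[OF a(1)] by (auto simp: a(2) b_def G.topspace_eq_carrier)
    with closed_at G.openin_left_preimage[OF U(1) b] obtain W
      where W: "openin S W" "p k \<in> W" "{x \<in> carrier G. p x \<in> W} \<subseteq> {x \<in> carrier G. b \<otimes>\<^bsub>G\<^esub> x \<in> U}"
      by blast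
    \<comment> \<open>The translate of \<open>W\<close> by \<open>p b\<close>. It is a neighbourhood
      of \<open>y\<close>, because \<open>p b\<close> carries \<open>p k\<close> to
      \<open>p a\<close>.\<close>
    let ?W = "{y \<in> carrier H. inv\<^bsub>H\<^esub> (p b) \<otimes>\<^bsub>H\<^esub> y \<in> W}"
    have "inv\<^bsub>H\<^esub> (p b) \<otimes>\<^bsub>H\<^esub> y = p k"
      using a k by (simp add: b_def H.inv_mult_group H.m_assoc)
    moreover have "x \<in> U" if x: "x \<in> carrier G" "inv\<^bsub>H\<^esub> (p b) \<otimes>\<^bsub>H\<^esub> p x \<in> W" for x
    proof -
      have "inv\<^bsub>G\<^esub> b \<otimes>\<^bsub>G\<^esub> x \<in> {x \<in> carrier G. p x \<in> W}" using x b by simp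
      then have "b \<otimes>\<^bsub>G\<^esub> (inv\<^bsub>G\<^esub> b \<otimes>\<^bsub>G\<^esub> x) \<in> U" using W(3) by blast
      then show ?thesis using x b by (simp add: cancel)
    qed
    ultimately show ?thesis
      using H.openin_left_preimage[OF W(1), of "inv\<^bsub>H\<^esub> (p b)"] W(2) a b
      by (intro exI[of _ ?W]) (auto simp: G.topspace_eq_carrier)
  qed
  then have "closed_map T S p"
    using continuous_map_funspace[OF cont] unfolding closed_map_fibre_neighbourhood by blast
  moreover have "compactin T {x \<in> topspace T. p x = y}" if "y \<in> topspace S" for y
  proof -
    have "y \<in> p ` carrier G" using that by (simp add: onto H.topspace_eq_carrier)
    then obtain a where a: "a \<in> carrier G" "y = p a" by blast
    then have "continuous_map T T (\<lambda>x. (a \<otimes>\<^bsub>G\<^esub> inv\<^bsub>G\<^esub> k) \<otimes>\<^bsub>G\<^esub> x)"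
      using k by (intro G.continuous_map_left_mult) simp
    from image_compactin[OF compact_fibre this] show ?thesis
      using fibre[OF a(1)] by (simp add: a(2) G.topspace_eq_carrier)
  qed
  ultimately show ?thesis
    using hom cont onto
    by (simp add: perfect_hom_def perfect_map_def proper_map_def G.topspace_eq_carrier H.topspace_eq_carrier)
qed

section \<open>The two implications\<close>

lemma perfect_hom_imp_continuous_hom_onto:
  assumes "topological_group G T" "topological_group H S" "perfect_hom G T H S p"
  shows "continuous_hom_onto G T H S p"
  using assms
  by (simp add: perfect_hom_def perfect_map_def continuous_hom_onto_def topological_group.topspace_eq_carrier)

lemma PM_imp_M_factorizable:
  assumes G: "topological_group G T" and PM: "PM_factorizable G T"
  shows "M_factorizable G T"
  unfolding M_factorizable_def
proof (intro allI impI)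
  fix f assume "continuous_map T euclideanreal f"
  then obtain H :: "'a set monoid" and S p g
    where "topological_group H S" "metrizable_space S" "perfect_hom G T H S p"
      "continuous_map S euclideanreal g" "\<forall>x\<in>carrier G. f x = g (p x)"
    using PM unfolding PM_factorizable_def by blast
  then show "\<exists>(H :: 'a set monoid) S p g.
           topological_group H S \<and> metrizable_space S \<and> continuous_hom_onto G T H S p \<and>
           continuous_map S euclideanreal g \<and> (\<forall>x\<in>carrier G. f x = g (p x))"
    using perfect_hom_imp_continuous_hom_onto[OF G] by blast
qed

lemma perfect_hom_metrizable_imp_feathered:
  assumes G: "topological_group G T" and H: "topological_group H S"
    and S: "metrizable_space S" and p: "perfect_hom G T H S p"
  shows "feathered T"
proof -
  interpret H: topological_group H S by (fact H)
  have cont: "continuous_map T S p" and closed: "closed_map T S p" and onto: "p ` topspace T = topspace S"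
    and compact: "\<And>y. y \<in> topspace S \<Longrightarrow> compactin T {x \<in> topspace T. p x = y}"
    using p by (auto simp: perfect_hom_def perfect_map_def proper_map_def)
  have one: "\<one>\<^bsub>H\<^esub> \<in> topspace S" by (simp add: H.topspace_eq_carrier)
  define K where "K = {x \<in> topspace T. p x = \<one>\<^bsub>H\<^esub>}"
  obtain \<B> where B: "countable \<B>" "\<And>V. V \<in> \<B> \<Longrightarrow> openin S V"
    "\<And>U. openin S U \<Longrightarrow> \<one>\<^bsub>H\<^esub> \<in> U \<Longrightarrow> \<exists>V\<in>\<B>. \<one>\<^bsub>H\<^esub> \<in> V \<and> V \<subseteq> U"
    using metrizable_imp_first_countable[OF S] one unfolding first_countable_def by metis
  \<comment> \<open>Basic sets missing the identity are dropped, as their preimages do not contain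
    \<open>K\<close>.\<close>
  define \<U> where "\<U> = (\<lambda>V. {x \<in> topspace T. p x \<in> V}) ` {V \<in> \<B>. \<one>\<^bsub>H\<^esub> \<in> V}"
  have "countable_character_in T K"
    unfolding countable_character_in_def
  proof (intro exI conjI ballI allI impI)
    show "countable \<U>" using B(1) by (simp add: \<U>_def)
    show "openin T U" "K \<subseteq> U" if "U \<in> \<U>" for U
      using that B(2) openin_continuous_map_preimage[OF cont] by (auto simp: \<U>_def K_def)
    \<comment> \<open>Closedness of \<open>p\<close> at the kernel puts the preimage of a whole
      neighbourhood of the identity inside \<open>V\<close>, hence that of a basic one.\<close>
    fix V assume "openin T V \<and> K \<subseteq> V"
    then obtain W where W: "openin S W" "\<one>\<^bsub>H\<^esub> \<in> W" "{x \<in> topspace T. p x \<in> W} \<subseteq> V"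
      using closed one unfolding closed_map_fibre_neighbourhood K_def by blast
    then obtain B' where "B' \<in> \<B>" "\<one>\<^bsub>H\<^esub> \<in> B'" "B' \<subseteq> W" using B(3) by blast
    with W show "\<exists>U\<in>\<U>. U \<subseteq> V" by (force simp: \<U>_def)
  qed
  moreover have "K \<noteq> {}" using onto one by (force simp: K_def)
  moreover have "compactin T K" using compact[OF one] by (simp add: K_def)
  ultimately show ?thesis unfolding feathered_def by blast
qed

lemma feathered_M_factorizable_imp_PM:
  fixes G :: "('a, 'm) monoid_scheme"
  assumes G: "topological_group G T" and T: "feathered T" and M: "M_factorizable G T"
  shows "PM_factorizable G T"
proof (rule PM_factorizableI[OF G])
  fix f assume f: "continuous_map T euclideanreal f"
  interpret G: topological_group G T by (fact G)
  obtain K where K: "K \<noteq> {}" "compactin T K" "countable_character_in T K"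
    using T by (auto simp: feathered_def)
  have KG: "K \<subseteq> carrier G" using compactin_subset_topspace[OF K(2)] by (simp add: G.topspace_eq_carrier)
  obtain k where k: "k \<in> K" using K(1) by blast
  obtain U :: "nat \<Rightarrow> 'a set" where "\<forall>n. openin T (U n) \<and> K \<subseteq> U n"
    "\<forall>V. openin T V \<and> K \<subseteq> V \<longrightarrow> (\<exists>n. U n \<subseteq> V)"
    using countable_character_in_sequence[OF K(3) compactin_subset_topspace[OF K(2)]] by (elim exE conjE)
  then have U: "\<And>n. openin T (U n)" "\<And>n. K \<subseteq> U n"
    "\<And>V. openin T V \<Longrightarrow> K \<subseteq> V \<Longrightarrow> \<exists>n. U n \<subseteq> V"
    by simp_all
  have "\<exists>h. continuous_map T euclideanreal h \<and> h ` K \<subseteq> {0} \<and> h ` (topspace T - U n) \<subseteq> {1::real}" for n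
  proof -
    have "closedin T (topspace T - U n)" "disjnt K (topspace T - U n)"
      using U(1,2) by (auto simp: disjnt_iff)
    from Urysohn_completely_regular_compact_closed_alt[OF G.completely_regular K(2) this, of 1 0]
    obtain h where "continuous_map T euclideanreal h" "h ` (topspace T - U n) \<subseteq> {1::real}" "h ` K \<subseteq> {0}" .
    then show ?thesis by blast
  qed
  then obtain h where h: "\<And>n. continuous_map T euclideanreal (h n)" "\<And>n. h n ` K \<subseteq> {0}"
    "\<And>n. h n ` (topspace T - U n) \<subseteq> {1::real}" by metis
  \<comment> \<open>\<open>f\<close> sits at index 0 and \<open>h n\<close> at \<open>Suc n\<close>,
    so a single homomorphism serves them all and \<open>g 0\<close> recovers
    \<open>f\<close>.\<close>
  have "continuous_map T euclideanreal (case_nat f h n)" for n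
    using f h(1) by (cases n) auto
  then have "\<exists>(H :: (nat \<Rightarrow> 'a set) monoid) S p g.
    topological_group H S \<and> metrizable_space S \<and> continuous_hom_onto G T H S p \<and>
    (\<forall>n. continuous_map S euclideanreal (g n)) \<and> (\<forall>n. \<forall>x\<in>carrier G. case_nat f h n x = g n (p x))"
    by (rule M_factorizable_countable_family[OF G M])
  then obtain H :: "(nat \<Rightarrow> 'a set) monoid" and S p and g :: "nat \<Rightarrow> (nat \<Rightarrow> 'a set) \<Rightarrow> real"
    where H: "topological_group H S" "metrizable_space S" and p: "continuous_hom_onto G T H S p"
      and "\<forall>n. continuous_map S euclideanreal (g n)" "\<forall>n. \<forall>x\<in>carrier G. case_nat f h n x = g n (p x)"
    by (elim exE conjE)
  then have g: "\<And>n. continuous_map S euclideanreal (g n)"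
      "\<And>n x. x \<in> carrier G \<Longrightarrow> case_nat f h n x = g n (p x)"
    by simp_all
  have cont: "continuous_map T S p" using p by (simp add: continuous_hom_onto_def)
  have gh: "g (Suc n) (p x) = h n x" if "x \<in> carrier G" for n x
    using g(2)[OF that, of "Suc n"] by simp
  have less_1: "x \<in> U n" if x: "x \<in> carrier G" "h n x < 1" for x n
  proof (rule ccontr)
    assume "x \<notin> U n"
    then have "h n x \<in> h n ` (topspace T - U n)" using x(1) by (simp add: G.topspace_eq_carrier)
    then show False using h(3)[of n] x(2) by auto
  qed
  have hk: "h n k = 0" for n using h(2) k by blast
  define N where "N = {x \<in> carrier G. p x = p k}"
  \<comment> \<open>Each \<open>h n\<close> factors through \<open>p\<close>, so it vanishes on the
    fibre \<open>N\<close>, which therefore lies in every \<open>U n\<close>. A point outside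
    \<open>K\<close> is missed by some \<open>U n\<close>, since its complement is open and contains
    \<open>K\<close>.\<close>
  have "N \<subseteq> K"
  proof
    fix x assume x: "x \<in> N"
    then have "h n x = 0" for n using gh[of x n] gh[of k n] hk k KG by (auto simp: N_def)
    then have xU: "x \<in> U n" for n using x less_1 by (simp add: N_def)
    have open_x: "openin T (topspace T - {x})"
      using x by (intro openin_diff openin_topspace closedin_Hausdorff_singleton G.Hausdorff)
        (simp add: N_def G.topspace_eq_carrier)
    show "x \<in> K"
    proof (rule ccontr)
      assume "x \<notin> K"
      then have "K \<subseteq> topspace T - {x}" using compactin_subset_topspace[OF K(2)] by blast
      then obtain n where "U n \<subseteq> topspace T - {x}" using U(3) open_x by presburger
      then show False using xU[of n] by blast
    qed
  qed
  have SS: "p x \<in> topspace S" if "x \<in> carrier G" for x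
    using continuous_map_image_subset_topspace[OF cont] that by (auto simp: G.topspace_eq_carrier)
  have "closedin T N"
    using closedin_continuous_map_preimage[OF cont, of "{p k}"] SS[of k] k KG topological_group.Hausdorff[OF H(1)]
    by (auto simp: N_def G.topspace_eq_carrier closedin_Hausdorff_singleton)
  then have "compactin T N" using \<open>N \<subseteq> K\<close> K(2) closed_compactin by blast
  moreover have "\<exists>W. openin S W \<and> p k \<in> W \<and> {x \<in> carrier G. p x \<in> W} \<subseteq> V"
    if V: "openin T V" "N \<subseteq> V" for V
  proof -
    \<comment> \<open>Inside \<open>K\<close>, compactness keeps points outside \<open>V\<close> away from \<open>p k\<close>; outside \<open>K\<close>, the set \<open>U m\<close> does.\<close>
    have "compactin S (p ` (K \<inter> (topspace T - V)))"
      by (intro image_compactin[OF _ cont] compact_Int_closedin K(2)) (use V in blast)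
    moreover have "compactin S {p k}" using SS k KG by auto
    moreover have "disjnt {p k} (p ` (K \<inter> (topspace T - V)))"
      using V(2) KG by (auto simp: N_def)
    ultimately obtain W W' where W: "openin S W" "openin S W'" "p k \<in> W"
      "p ` (K \<inter> (topspace T - V)) \<subseteq> W'" "disjnt W W'"
      using Hausdorff_space_compact_separation[OF topological_group.Hausdorff[OF H(1)]]
      by (metis insert_subset)
    \<comment> \<open>Points of \<open>K\<close> outside \<open>V\<close> are mapped into
      \<open>W'\<close>, so this open set contains \<open>K\<close> and hence some
      \<open>U m\<close>.\<close>
    have "openin T ({x \<in> topspace T. p x \<in> W'} \<union> V)"
      using openin_continuous_map_preimage[OF cont W(2)] V(1) by blast
    moreover have "K \<subseteq> {x \<in> topspace T. p x \<in> W'} \<union> V"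
      using W(4) compactin_subset_topspace[OF K(2)] by blast
    ultimately obtain m where m: "U m \<subseteq> {x \<in> topspace T. p x \<in> W'} \<union> V" using U(3) by blast
    \<comment> \<open>The bound on \<open>g (Suc m)\<close> pulls back to \<open>h m x < 1\<close>,
      which forces \<open>x\<close> into \<open>U m\<close>. There either \<open>x\<close> is in
      \<open>V\<close> or \<open>p x\<close> is in \<open>W'\<close>, and \<open>W\<close> excludes
      the latter.\<close>
    let ?Z = "W \<inter> {y \<in> topspace S. g (Suc m) y \<in> {..<1}}"
    have "openin S ?Z"
      by (intro openin_Int W(1) openin_continuous_map_preimage[OF g(1)]) simp
    moreover have "p k \<in> ?Z" using W(3) SS gh hk k KG by auto
    moreover have "x \<in> V" if "x \<in> carrier G" "p x \<in> ?Z" for x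
      using that less_1[of x m] gh[of x m] m W(5) by (auto simp: disjnt_iff)
    ultimately show ?thesis by (intro exI[of _ ?Z]) blast
  qed
  ultimately have "perfect_hom G T H S p"
    using perfect_homI[OF G H(1) p, of k] k KG unfolding N_def by blast
  moreover have "f x = g 0 (p x)" if "x \<in> carrier G" for x using g(2)[OF that, of 0] by simp
  ultimately show "\<exists>(H :: (nat \<Rightarrow> 'a set) monoid) S p g.
           topological_group H S \<and> metrizable_space S \<and> perfect_hom G T H S p \<and>
           continuous_map S euclideanreal g \<and> (\<forall>x\<in>carrier G. f x = g (p x))"
    using H g(1) by blast
qed

theorem theorem3p3:
  fixes G :: "('a, 'm) monoid_scheme" and T :: "'a topology"
  assumes "topological_group G T"
  shows "PM_factorizable G T \<longleftrightarrow> feathered T \<and> M_factorizable G T"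
proof
  assume PM: "PM_factorizable G T"
  \<comment> \<open>Factoring even a constant function yields a perfect homomorphism onto a
    metrizable group, from which featheredness follows.\<close>
  moreover have "continuous_map T euclideanreal (\<lambda>_. 0)" by simp
  ultimately have "feathered T"
    using perfect_hom_metrizable_imp_feathered[OF assms] unfolding PM_factorizable_def by metis
  with PM show "feathered T \<and> M_factorizable G T"
    using PM_imp_M_factorizable assms by blast
qed (use assms feathered_M_factorizable_imp_PM in blast)

end
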